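(* Let $d>1$ and $f\ge0$ be integers, let $n=2d+f$, and let $\beta\in\mathcal S_n$ have cycle structure $d^2\cdot1^f$ (two $d$-cycles and $f$ fixed points). Then $(\varepsilon,\beta,\beta;(12))\in\mathrm{Par}(n)$ if and only if either <ul> <li>(i) $d$ is even and $f=0$, or</li> <li>(ii) $d$ is odd and $f\le d+1$.</li> </ul>
   Context: A Latin square of order $n$ is an $n\times n$ array with rows, columns and symbols indexed by $[n]$, each symbol occurring once in each row and each column, with triple set $O(L)$. Permutations act on the right; $\varepsilon$ is the identity. A paratopism $(\alpha,\beta,\gamma;(12))$ maps $L$ to $L^\sigma$ with triple set $\{(y\beta,x\alpha,z\gamma):(x,y,z)\in O(L)\}$; it is an autoparatopism of $L$ if $L^\sigma=L$. $\mathrm{Par}(n)$ is the set of paratopisms that are autoparatopisms of at least one Latin square of order $n$. *)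

theory Defs
  imports "HOL-Combinatorics.Combinatorics"
begin

text \<open>Latin squares of order n, rows/columns/symbols indexed by [n] = {1..n},
  represented by their triple set O(L).\<close>
definition latin_square :: "nat \<Rightarrow> (nat \<times> nat \<times> nat) set \<Rightarrow> bool" where
  "latin_square n L \<longleftrightarrow>
     L \<subseteq> {1..n} \<times> {1..n} \<times> {1..n} \<and>
     (\<forall>x\<in>{1..n}. \<forall>y\<in>{1..n}. \<exists>!z. (x, y, z) \<in> L) \<and>
     (\<forall>x\<in>{1..n}. \<forall>z\<in>{1..n}. \<exists>!y. (x, y, z) \<in> L) \<and>
     (\<forall>y\<in>{1..n}. \<forall>z\<in>{1..n}. \<exists>!x. (x, y, z) \<in> L)"

text \<open>Image of L under the paratopism (alpha,beta,gamma;(12)); permutations act on the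
  right, so x alpha is written alpha x.\<close>
definition paratopism_12_image ::
  "(nat \<Rightarrow> nat) \<Rightarrow> (nat \<Rightarrow> nat) \<Rightarrow> (nat \<Rightarrow> nat) \<Rightarrow> (nat \<times> nat \<times> nat) set \<Rightarrow> (nat \<times> nat \<times> nat) set" where
  "paratopism_12_image \<alpha> \<beta> \<gamma> L = {(\<beta> y, \<alpha> x, \<gamma> z) | x y z. (x, y, z) \<in> L}"

definition in_Par_12 :: "nat \<Rightarrow> (nat \<Rightarrow> nat) \<Rightarrow> (nat \<Rightarrow> nat) \<Rightarrow> (nat \<Rightarrow> nat) \<Rightarrow> bool" where
  "in_Par_12 n \<alpha> \<beta> \<gamma> \<longleftrightarrow>
     \<alpha> permutes {1..n} \<and> \<beta> permutes {1..n} \<and> \<gamma> permutes {1..n} \<and>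
     (\<exists>L. latin_square n L \<and> paratopism_12_image \<alpha> \<beta> \<gamma> L = L)"

definition cycle_structure_d2_1f :: "nat \<Rightarrow> (nat \<Rightarrow> nat) \<Rightarrow> nat \<Rightarrow> nat \<Rightarrow> bool" where
  "cycle_structure_d2_1f n \<beta> d f \<longleftrightarrow>
     (let C = (\<lambda>x. orbit \<beta> x) ` {1..n} in
       card {c \<in> C. card c = d} = 2 \<and> card {c \<in> C. card c = 1} = f \<and>
       (\<forall>c\<in>C. card c = d \<or> card c = 1))"

end

theory Submission
  imports Defs
begin

text \<open>
  Write \<open>x * y\<close> for the entry of the square in cell \<open>(x, y)\<close>. Being an autoparatopism means
  \<open>\<beta> y * x = \<beta> (x * y)\<close>; hence \<open>\<beta> x * \<beta> y = \<beta>\<^sup>2 (x * y)\<close>, and columns are permutations as soon as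
  rows are. Label the two cycles of \<open>\<beta>\<close> as \<open>A i\<close>, \<open>B i\<close> with \<open>i\<close> modulo \<open>d\<close>, and the fixed points
  as \<open>Inf k\<close>.

  Necessity: if \<open>d\<close> is even and \<open>x\<close> is a fixed point, then \<open>x * \<beta>\<^bsup>d/2\<^esup> y = \<beta>\<^bsup>d\<^esup> (x * y) = x * y\<close>. If \<open>d\<close> is odd,
  a fixed symbol in row \<open>A 0\<close> cannot lie in a fixed column, and if it lies in column \<open>A j\<close> then
  comparing its images in row \<open>A (j + 1)\<close> forces \<open>2 j + 1 = 0\<close> modulo \<open>d\<close>. So only \<open>d + 1\<close> columns
  are available for the \<open>f\<close> fixed symbols.

  Sufficiency: for \<open>f = 0\<close> the Cayley table of the product of the groups of integers modulo 2 and
  modulo \<open>d\<close> works. For \<open>0 < f \<le> d\<close> (\<open>d\<close> odd), choose a set \<open>D\<close> of \<open>f\<close> residues invariant under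
  \<open>\<delta> \<mapsto> 1 - \<delta>\<close>, put one fixed symbol on each diagonal \<open>i - j = \<delta> \<in> D\<close> of the \<open>A \<times> B\<close> block, and
  replace \<open>A\<close>-symbols by \<open>B\<close>-symbols on these diagonals of the \<open>B \<times> B\<close> block; the displaced symbols
  fill the new rows and columns. For \<open>f = d + 1\<close>, the last fixed symbol goes on the self-paired
  diagonal \<open>2 \<delta> = 1\<close> of both diagonal blocks.
\<close>

section \<open>Latin squares as twisted operations\<close>

text \<open>The carrier is arbitrary so that one notion serves both \<open>{1..n}\<close> and the
  labelled model. Only rows are required to be injective; the twist transfers this to
  columns.\<close>

definition twisted_op :: "'a set \<Rightarrow> ('a \<Rightarrow> 'a) \<Rightarrow> ('a \<Rightarrow> 'a \<Rightarrow> 'a) \<Rightarrow> bool" where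
  "twisted_op S s m \<longleftrightarrow>
     (\<forall>x\<in>S. \<forall>y\<in>S. m x y \<in> S) \<and> (\<forall>x\<in>S. inj_on (m x) S) \<and>
     (\<forall>x\<in>S. \<forall>y\<in>S. m (s y) x = s (m x y))"

lemma twisted_op_closed: "twisted_op S s m \<Longrightarrow> x \<in> S \<Longrightarrow> y \<in> S \<Longrightarrow> m x y \<in> S"
  by (simp add: twisted_op_def)

lemma twisted_op_left_cancel:
  "twisted_op S s m \<Longrightarrow> x \<in> S \<Longrightarrow> y \<in> S \<Longrightarrow> y' \<in> S \<Longrightarrow> m x y = m x y' \<Longrightarrow> y = y'"
  by (auto simp: twisted_op_def dest: inj_onD)

lemma twisted_op_twist:
  "twisted_op S s m \<Longrightarrow> x \<in> S \<Longrightarrow> y \<in> S \<Longrightarrow> m (s y) x = s (m x y)"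
  by (simp add: twisted_op_def)

text \<open>Column \<open>y\<close> becomes row \<open>s y\<close> after applying \<open>s\<close>
  to its entries, so row injectivity applies.\<close>

lemma twisted_op_right_cancel:
  assumes m: "twisted_op S s m" and s: "\<And>x. x \<in> S \<Longrightarrow> s x \<in> S"
    and "x \<in> S" "x' \<in> S" "y \<in> S" "m x y = m x' y"
  shows "x = x'"
proof -
  have "m (s y) x = m (s y) x'"
    using assms by (simp add: twisted_op_twist[OF m])
  then show ?thesis
    using assms by (auto intro: twisted_op_left_cancel[OF m])
qed

lemma twisted_op_row_onto:
  assumes m: "twisted_op S s m" and "finite S" "x \<in> S"
  shows "m x ` S = S"
  using assms by (intro endo_inj_surj) (auto simp: twisted_op_def)

lemma twisted_op_column_onto:
  assumes m: "twisted_op S s m" and s: "\<And>x. x \<in> S \<Longrightarrow> s x \<in> S" and "finite S" "y \<in> S"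
  shows "(\<lambda>x. m x y) ` S = S"
  using assms
  by (intro endo_inj_surj inj_onI)
    (auto simp: twisted_op_closed[OF m] intro: twisted_op_right_cancel[OF m s])

text \<open>One twist swaps the arguments and two restore their order, so moving both arguments by
  \<open>s\<close> costs two applications of \<open>s\<close> on the symbol.\<close>

lemma twisted_op_funpow:
  assumes m: "twisted_op S s m" and s: "\<And>x. x \<in> S \<Longrightarrow> s x \<in> S" and "x \<in> S" "y \<in> S"
  shows "m ((s ^^ k) x) ((s ^^ k) y) = (s ^^ (2 * k)) (m x y)"
proof -
  have S: "(s ^^ k) z \<in> S" if "z \<in> S" for z k
    using that by (induction k) (auto simp: s)
  show ?thesis
    using assms(3,4) by (induction k) (auto simp: twisted_op_twist[OF m] S s)
qed

text \<open>Conjugating the operation by \<phi> preserves all three conditions, which allows \<beta>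
  to be replaced by a standard permutation with the same cycles.\<close>

lemma twisted_op_transport:
  assumes bij: "bij_betw \<phi> S T" and s: "\<And>x. x \<in> S \<Longrightarrow> s x \<in> S"
    and eq: "\<And>x. x \<in> S \<Longrightarrow> \<phi> (s x) = t (\<phi> x)"
  shows "(\<exists>m. twisted_op S s m) \<longleftrightarrow> (\<exists>m. twisted_op T t m)"
proof
  have inv: "inv_into S \<phi> y \<in> S" "\<phi> (inv_into S \<phi> y) = y" if "y \<in> T" for y
    using that bij by (auto simp: bij_betw_def f_inv_into_f inv_into_into)
  have inv': "inv_into S \<phi> (\<phi> x) = x" if "x \<in> S" for x
    using that bij by (auto simp: bij_betw_def)
  have \<phi>T: "\<phi> x \<in> T" if "x \<in> S" for x
    using that bij by (auto simp: bij_betw_def)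
  have teq: "inv_into S \<phi> (t y) = s (inv_into S \<phi> y)" if "y \<in> T" for y
    using eq[OF inv(1)[OF that]] inv[OF that] inv' s by metis
  show "\<exists>m. twisted_op T t m" if ex: "\<exists>m. twisted_op S s m"
  proof -
    obtain m where m: "twisted_op S s m" using ex by blast
    have "twisted_op T t (\<lambda>x y. \<phi> (m (inv_into S \<phi> x) (inv_into S \<phi> y)))"
      unfolding twisted_op_def
    proof (intro conjI ballI inj_onI)
      fix x y y' assume T: "x \<in> T" "y \<in> T" "y' \<in> T"
        and e: "\<phi> (m (inv_into S \<phi> x) (inv_into S \<phi> y)) = \<phi> (m (inv_into S \<phi> x) (inv_into S \<phi> y'))"
      from e have "m (inv_into S \<phi> x) (inv_into S \<phi> y) = m (inv_into S \<phi> x) (inv_into S \<phi> y')"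
        by (metis T inv' inv(1) twisted_op_closed[OF m])
      then show "y = y'" by (metis T inv twisted_op_left_cancel[OF m])
    qed (auto simp: teq inv eq \<phi>T twisted_op_twist[OF m] twisted_op_closed[OF m])
    then show ?thesis by blast
  qed
  show "\<exists>m. twisted_op S s m" if ex: "\<exists>m. twisted_op T t m"
  proof -
    obtain m where m: "twisted_op T t m" using ex by blast
    have "twisted_op S s (\<lambda>x y. inv_into S \<phi> (m (\<phi> x) (\<phi> y)))"
      unfolding twisted_op_def
    proof (intro conjI ballI inj_onI)
      fix x y y' assume S: "x \<in> S" "y \<in> S" "y' \<in> S"
        and e: "inv_into S \<phi> (m (\<phi> x) (\<phi> y)) = inv_into S \<phi> (m (\<phi> x) (\<phi> y'))"
      from e have "m (\<phi> x) (\<phi> y) = m (\<phi> x) (\<phi> y')"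
        by (metis S \<phi>T inv(2) twisted_op_closed[OF m])
      then show "y = y'" by (metis S \<phi>T inv' twisted_op_left_cancel[OF m])
    qed (auto simp: teq inv eq \<phi>T twisted_op_twist[OF m] twisted_op_closed[OF m])
    then show ?thesis by blast
  qed
qed

lemma in_Par_12_iff_twisted_op:
  assumes \<beta>: "\<beta> permutes {1..n}"
  shows "in_Par_12 n id \<beta> \<beta> \<longleftrightarrow> (\<exists>m. twisted_op {1..n} \<beta> m)"
proof
  let ?T = "{1..n}"
  have \<beta>T: "\<beta> x \<in> ?T" if "x \<in> ?T" for x
    using permutes_in_image[OF \<beta>] that by blast
  show "\<exists>m. twisted_op ?T \<beta> m" if "in_Par_12 n id \<beta> \<beta>"
  proof -
    obtain L where L: "latin_square n L" "paratopism_12_image id \<beta> \<beta> L = L"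
      using \<open>in_Par_12 n id \<beta> \<beta>\<close> by (auto simp: in_Par_12_def)
    define m where "m x y = (THE z. (x, y, z) \<in> L)" for x y
    have ex1: "\<exists>!z. (x, y, z) \<in> L" if "x \<in> ?T" "y \<in> ?T" for x y
      using L(1) that by (auto simp: latin_square_def)
    have mL: "(x, y, m x y) \<in> L" if "x \<in> ?T" "y \<in> ?T" for x y
      unfolding m_def using theI'[OF ex1[OF that]] .
    have sub: "z \<in> ?T" if "(x, y, z) \<in> L" for x y z
      using L(1) that by (auto simp: latin_square_def)
    have "twisted_op ?T \<beta> m"
      unfolding twisted_op_def
    proof (intro conjI ballI inj_onI)
      show "m x y \<in> ?T" if "x \<in> ?T" "y \<in> ?T" for x y
        using sub mL that by blast
      fix x y y' assume T: "x \<in> ?T" "y \<in> ?T" "y' \<in> ?T" and e: "m x y = m x y'"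
      have "m x y \<in> ?T" using sub mL T by blast
      then have "\<exists>!w. (x, w, m x y) \<in> L"
        using L(1) T(1) by (simp add: latin_square_def)
      then show "y = y'"
        using mL[OF T(1,2)] mL[OF T(1,3)] e by metis
    next
      fix x y assume T: "x \<in> ?T" "y \<in> ?T"
      have "(\<beta> y, x, \<beta> (m x y)) \<in> paratopism_12_image id \<beta> \<beta> L"
        unfolding paratopism_12_image_def using mL[OF T] by force
      then have "(\<beta> y, x, \<beta> (m x y)) \<in> L" by (simp only: L(2))
      then show "m (\<beta> y) x = \<beta> (m x y)"
        using mL[OF \<beta>T[OF T(2)] T(1)] ex1[OF \<beta>T[OF T(2)] T(1)] by blast
    qed
    then show ?thesis by blast
  qed
  show "in_Par_12 n id \<beta> \<beta>" if ex: "\<exists>m. twisted_op ?T \<beta> m"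
  proof -
    obtain m where m: "twisted_op ?T \<beta> m" using ex by blast
    define L where "L = {(x, y, m x y) | x y. x \<in> ?T \<and> y \<in> ?T}"
    have L_iff: "(x, y, z) \<in> L \<longleftrightarrow> x \<in> ?T \<and> y \<in> ?T \<and> z = m x y" for x y z
      by (auto simp: L_def)
    have "latin_square n L"
      unfolding latin_square_def
    proof (intro conjI ballI)
      show "L \<subseteq> ?T \<times> ?T \<times> ?T"
        unfolding L_def using twisted_op_closed[OF m] by blast
      show "\<exists>!z. (x, y, z) \<in> L" if "x \<in> ?T" "y \<in> ?T" for x y
        using that by (auto simp: L_def)
      show "\<exists>!y. (x, y, z) \<in> L" if xyz: "x \<in> ?T" "z \<in> ?T" for x z
      proof -
        obtain y where y: "y \<in> ?T" "m x y = z"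
          using twisted_op_row_onto[OF m _ xyz(1)] xyz(2) by (metis finite_atLeastAtMost imageE)
        show ?thesis
        proof (rule ex1I[of _ y])
          show "(x, y, z) \<in> L" using xyz y by (simp add: L_iff)
          show "y' = y" if "(x, y', z) \<in> L" for y'
            using that y twisted_op_left_cancel[OF m xyz(1)] unfolding L_iff by metis
        qed
      qed
      show "\<exists>!x. (x, y, z) \<in> L" if xyz: "y \<in> ?T" "z \<in> ?T" for y z
      proof -
        obtain x where x: "x \<in> ?T" "m x y = z"
          using twisted_op_column_onto[OF m \<beta>T _ xyz(1)] xyz(2)
          by (metis (no_types, lifting) finite_atLeastAtMost imageE)
        show ?thesis
        proof (rule ex1I[of _ x])
          show "(x, y, z) \<in> L" using xyz x by (simp add: L_iff)
          show "x' = x" if "(x', y, z) \<in> L" for x'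
            using that x twisted_op_right_cancel[OF m \<beta>T _ _ xyz(1)] unfolding L_iff by metis
        qed
      qed
    qed
    moreover have "paratopism_12_image id \<beta> \<beta> L = L"
    proof (intro equalityI subsetI)
      fix t assume "t \<in> paratopism_12_image id \<beta> \<beta> L"
      then obtain x y where "x \<in> ?T" "y \<in> ?T" "t = (\<beta> y, x, \<beta> (m x y))"
        by (auto simp: paratopism_12_image_def L_def)
      then show "t \<in> L"
        using twisted_op_twist[OF m] \<beta>T unfolding L_def by force
    next
      fix t assume "t \<in> L"
      then obtain u v where uv: "u \<in> ?T" "v \<in> ?T" "t = (u, v, m u v)"
        by (auto simp: L_def)
      \<comment> \<open>Surjectivity of \<beta> writes the row as \<open>\<beta> y\<close>, which
        exhibits \<open>(v, y)\<close> as the cell mapped to \<open>(u, v)\<close>.\<close>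
      obtain y where y: "y \<in> ?T" "u = \<beta> y"
        using permutes_image[OF \<beta>] uv(1) by blast
      have "t = (\<beta> y, id v, \<beta> (m v y))"
        using uv y twisted_op_twist[OF m uv(2) y(1)] by simp
      moreover have "(v, y, m v y) \<in> L" using uv y by (auto simp: L_def)
      ultimately show "t \<in> paratopism_12_image id \<beta> \<beta> L"
        unfolding paratopism_12_image_def by blast
    qed
    ultimately show ?thesis
      unfolding in_Par_12_def using \<beta> permutes_id by blast
  qed
qed

section \<open>The model permutation\<close>

text \<open>Integer labels let differences such as \<open>i - j\<close> be reduced modulo
  \<open>d\<close> without truncation.\<close>

datatype point = A int | B int | Inf int

definition points :: "int \<Rightarrow> int \<Rightarrow> point set" where
  "points d f = A ` {0..<d} \<union> B ` {0..<d} \<union> Inf ` {0..<f}"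

fun shift :: "int \<Rightarrow> point \<Rightarrow> point" where
  "shift d (A i) = A ((i + 1) mod d)"
| "shift d (B i) = B ((i + 1) mod d)"
| "shift d (Inf k) = Inf k"

lemma points_simps [simp]:
  "A i \<in> points d f \<longleftrightarrow> 0 \<le> i \<and> i < d"
  "B i \<in> points d f \<longleftrightarrow> 0 \<le> i \<and> i < d"
  "Inf k \<in> points d f \<longleftrightarrow> 0 \<le> k \<and> k < f"
  by (auto simp: points_def)

lemma finite_points [simp]: "finite (points d f)"
  by (simp add: points_def)

lemma card_points: "card (points (int d) (int f)) = 2 * d + f"
proof -
  have "card (A ` {0..<int d}) = d" "card (B ` {0..<int d}) = d" "card (Inf ` {0..<int f}) = f"
    by (simp_all add: card_image inj_on_def)
  then show ?thesis
    unfolding points_def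
    by (subst card_Un_disjoint, simp, simp, force)+ simp
qed

lemma shift_in_points: "0 < d \<Longrightarrow> x \<in> points d f \<Longrightarrow> shift d x \<in> points d f"
  by (cases x) auto

lemma funpow_shift:
  assumes "0 < d" "x \<in> points d f"
  shows "(shift d ^^ k) x =
    (case x of A i \<Rightarrow> A ((i + int k) mod d) | B i \<Rightarrow> B ((i + int k) mod d) | Inf l \<Rightarrow> Inf l)"
  using assms by (induction k) (auto split: point.split simp: mod_simps algebra_simps)

section \<open>Necessity\<close>

lemma twisted_op_even_imp:
  assumes d: "even d" "d > 1" and m: "twisted_op (points (int d) (int f)) (shift (int d)) m"
  shows "f = 0"
proof (rule ccontr)
  assume "f \<noteq> 0"
  let ?S = "points (int d) (int f)" and ?s = "shift (int d)"
  have S: "Inf 0 \<in> ?S" "A 0 \<in> ?S" using \<open>f \<noteq> 0\<close> d by auto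
  have shift: "?s x \<in> ?S" if "x \<in> ?S" for x using that d by (simp add: shift_in_points)
  \<comment> \<open>Half a turn moves \<open>A 0\<close> but not \<open>Inf 0\<close>, while the
    symbol makes a full turn. Row \<open>Inf 0\<close> thus repeats a symbol.\<close>
  have "m ((?s ^^ (d div 2)) (Inf 0)) ((?s ^^ (d div 2)) (A 0)) = (?s ^^ (2 * (d div 2))) (m (Inf 0) (A 0))"
    using twisted_op_funpow[OF m shift S] by simp
  also have "\<dots> = m (Inf 0) (A 0)"
    using funpow_shift[OF _ twisted_op_closed[OF m S], of d] twisted_op_closed[OF m S] d
    by (auto split: point.split)
  finally have "m (Inf 0) (A (int (d div 2))) = m (Inf 0) (A 0)"
    using d S by (simp add: funpow_shift[where f = "int f"])
  from twisted_op_left_cancel[OF m S(1) _ S(2) this] have "A (int (d div 2)) = A 0"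
    using d by simp
  then show False using d by simp
qed

lemma twisted_op_odd_imp:
  assumes d: "odd d" "d > 1" and m: "twisted_op (points (int d) (int f)) (shift (int d)) m"
  shows "f \<le> d + 1"
proof -
  let ?S = "points (int d) (int f)" and ?s = "shift (int d)"
  have S: "A 0 \<in> ?S" using d by auto
  have shift: "?s x \<in> ?S" if "x \<in> ?S" for x using that d by (simp add: shift_in_points)
  \<comment> \<open>The extra column is the solution of \<open>2 * j + 1 = d\<close>; with the
    \<open>d\<close> columns \<open>B j\<close> it gives the bound.\<close>
  let ?Y = "insert (A ((int d - 1) div 2)) (B ` {0..<int d})"
  have "Inf ` {0..<int f} \<subseteq> m (A 0) ` ?Y"
  proof (rule image_subsetI)
    fix k assume "k \<in> {0..<int f}"
    then have "Inf k \<in> m (A 0) ` ?S" using twisted_op_row_onto[OF m _ S] by simp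
    then obtain y where y: "y \<in> ?S" "m (A 0) y = Inf k" by (metis imageE)
    \<comment> \<open>A fixed symbol is unchanged by every power of the shift, so it occupies all
      simultaneous translates of its cell.\<close>
    have pow: "m ((?s ^^ l) (A 0)) ((?s ^^ l) y) = Inf k" for l
      using twisted_op_funpow[OF m shift S y(1), of l] y(2) d \<open>k \<in> _\<close>
      by (simp add: funpow_shift[where f = "int f"])
    have "y \<in> ?Y"
    proof (cases y)
      case (A j)
      then have j: "0 \<le> j" "j < int d" using y(1) by auto
      \<comment> \<open>The twist puts \<open>Inf k\<close> in column \<open>A 0\<close> of row
        \<open>A (j + 1)\<close>; translating the original cell by \<open>j + 1\<close> puts it in
        column \<open>A (2 * j + 1)\<close> of the same row, indices modulo
        \<open>d\<close>.\<close>
      have y0: "m (?s y) (A 0) = Inf k"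
        using twisted_op_twist[OF m S y(1)] y(2) by simp
      have "m (?s y) (A ((2 * j + 1) mod int d)) = Inf k"
        using pow[of "nat (j + 1)"] j A S d
        by (simp add: funpow_shift[where f = "int f"] algebra_simps)
      from twisted_op_left_cancel[OF m shift[OF y(1)] _ S trans[OF this y0[symmetric]]]
      have "A ((2 * j + 1) mod int d) = A 0"
        using d by simp
      then obtain q where q: "2 * j + 1 = int d * q" by (auto elim: dvdE)
      have "0 < int d * q" "int d * q < int d * 2" using q j by linarith+
      then have "q = 1" using d by (simp add: zero_less_mult_iff)
      then show ?thesis using A q by auto
    next
      case (B j)
      then show ?thesis using y(1) by auto
    next
      case (Inf l)
      \<comment> \<open>A fixed column is its own translate, so \<open>Inf k\<close> would occur in
        it in rows \<open>A 0\<close> and \<open>A 1\<close>.\<close>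
      have "m (A (1 mod int d)) y = Inf k"
        using pow[of 1] Inf by simp
      from twisted_op_right_cancel[OF m shift _ S y(1) trans[OF this y(2)[symmetric]]]
      have "A (1 mod int d) = A 0"
        using d by simp
      then show ?thesis using d by simp
    qed
    then show "Inf k \<in> m (A 0) ` ?Y" using y(2) by (metis imageI)
  qed
  then have "card (Inf ` {0..<int f}) \<le> card (m (A 0) ` ?Y)"
    by (intro card_mono) auto
  also have "\<dots> \<le> card ?Y" by (intro card_image_le) auto
  also have "\<dots> = d + 1"
    by (subst card_insert_disjoint) (auto simp: card_image inj_on_def)
  finally show ?thesis by (simp add: card_image inj_on_def)
qed

section \<open>Conjugating \<beta> to the model\<close>

text \<open>The size of an orbit is the first return time \<open>funpow_dist1\<close>.\<close>

lemma funpow_onto_orbit: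
  assumes "permutation \<beta>"
  shows "(\<lambda>k. (\<beta> ^^ k) x) ` {0..<card (orbit \<beta> x)} = orbit \<beta> x" "(\<beta> ^^ card (orbit \<beta> x)) x = x"
proof -
  let ?k = "funpow_dist1 \<beta> x x"
  have x: "x \<in> orbit \<beta> x" using assms by (rule permutation_self_in_orbit)
  have "card (orbit \<beta> x) = ?k"
    using orbit_conv_funpow_dist1[OF x] inj_on_funpow_dist1[OF x]
    by (metis card_atLeastLessThan card_image diff_zero)
  then show "(\<lambda>k. (\<beta> ^^ k) x) ` {0..<card (orbit \<beta> x)} = orbit \<beta> x"
    "(\<beta> ^^ card (orbit \<beta> x)) x = x"
    using orbit_conv_funpow_dist1[OF x] funpow_dist1_prop[OF x] by simp_all
qed

text \<open>A base point is chosen in each long cycle and labels count powers of \<beta> from it;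
  the fixed points are numbered arbitrarily.\<close>

lemma cycle_structure_d2_1f_conjugate_shift:
  assumes d: "d > 1" and n: "n = 2 * d + f" and \<beta>: "\<beta> permutes {1..n}"
    and cs: "cycle_structure_d2_1f n \<beta> d f"
  obtains \<phi> where "bij_betw \<phi> (points (int d) (int f)) {1..n}"
    "\<And>x. x \<in> points (int d) (int f) \<Longrightarrow> \<phi> (shift (int d) x) = \<beta> (\<phi> x)"
proof -
  have perm: "permutation \<beta>" using \<beta> permutation_permutes by blast
  define C where "C = orbit \<beta> ` {1..n}"
  have C: "card {c \<in> C. card c = d} = 2" "card {c \<in> C. card c = 1} = f"
    "\<And>c. c \<in> C \<Longrightarrow> card c = d \<or> card c = 1"
    using cs by (auto simp: cycle_structure_d2_1f_def C_def Let_def)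
  obtain c1 c2 where "{c \<in> C. card c = d} = {c1, c2}" using C(1) by (auto simp: card_2_iff)
  moreover from this have "c1 \<in> C \<and> card c1 = d" "c2 \<in> C \<and> card c2 = d" by blast+
  ultimately obtain a b where a: "a \<in> {1..n}" "card (orbit \<beta> a) = d" and b: "b \<in> {1..n}" "card (orbit \<beta> b) = d"
    and ab: "{c \<in> C. card c = d} = {orbit \<beta> a, orbit \<beta> b}"
    unfolding C_def by auto
  define F where "F = {x \<in> {1..n}. card (orbit \<beta> x) = 1}"
  have self: "x \<in> orbit \<beta> x" for x using perm by (rule permutation_self_in_orbit)
  have F1: "orbit \<beta> x = {x}" if "x \<in> F" for x
    using that self[of x] by (auto simp: F_def card_1_singleton_iff)
  have "inj_on (orbit \<beta>) F" using F1 by (auto intro!: inj_onI)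
  moreover have "orbit \<beta> ` F = {c \<in> C. card c = 1}" by (auto simp: F_def C_def)
  ultimately have "card F = card {0..<int f}" using C(2) by (metis card_image card_atLeastLessThan_int diff_zero nat_int)
  then obtain g where g: "bij_betw g {0..<int f} F"
    using finite_same_card_bij[of "{0..<int f}" F] by (auto simp: F_def)
  define \<phi> where "\<phi> x = (case x of A i \<Rightarrow> (\<beta> ^^ nat i) a | B i \<Rightarrow> (\<beta> ^^ nat i) b | Inf k \<Rightarrow> g k)" for x
  have cyc: "(\<lambda>i. (\<beta> ^^ nat i) x) ` {0..<int d} = orbit \<beta> x" if "card (orbit \<beta> x) = d" for x
  proof -
    have "(\<lambda>i. (\<beta> ^^ nat i) x) ` {0..<int d} = (\<lambda>k. (\<beta> ^^ k) x) ` (nat ` {0..<int d})"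
      by (simp add: image_image)
    also have "nat ` {0..<int d} = {0..<d}"
      by (auto simp: image_iff intro!: bexI[where x = "int _"])
    finally show ?thesis using funpow_onto_orbit(1)[OF perm] that by metis
  qed
  have onto: "\<phi> ` points (int d) (int f) = {1..n}"
  proof -
    have "\<phi> ` points (int d) (int f) = orbit \<beta> a \<union> orbit \<beta> b \<union> F"
      using cyc[OF a(2)] cyc[OF b(2)] g
      by (simp add: points_def image_Un image_image \<phi>_def bij_betw_def)
    also have "\<dots> = {1..n}"
    proof (intro equalityI subsetI)
      show "x \<in> {1..n}" if "x \<in> orbit \<beta> a \<union> orbit \<beta> b \<union> F" for x
        using that permutes_orbit_subset[OF \<beta> a(1)] permutes_orbit_subset[OF \<beta> b(1)]
        by (auto simp: F_def)
      show "x \<in> orbit \<beta> a \<union> orbit \<beta> b \<union> F" if x: "x \<in> {1..n}" for x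
      proof (cases "card (orbit \<beta> x) = d")
        case True
        then have "orbit \<beta> x \<in> {orbit \<beta> a, orbit \<beta> b}" using x ab by (auto simp: C_def)
        then show ?thesis using self[of x] by auto
      next
        case False
        then show ?thesis using C(3)[of "orbit \<beta> x"] x by (simp add: F_def C_def)
      qed
    qed
    finally show ?thesis .
  qed
  \<comment> \<open>Injectivity follows by counting: \<open>2 * d + f\<close> points map onto
    \<open>n\<close> elements.\<close>
  have "bij_betw \<phi> (points (int d) (int f)) {1..n}"
    unfolding bij_betw_def using onto by (auto intro!: eq_card_imp_inj_on simp: card_points n)
  moreover have "\<phi> (shift (int d) x) = \<beta> (\<phi> x)" if x: "x \<in> points (int d) (int f)" for x
  proof -
    \<comment> \<open>At \<open>i + 1 = d\<close> the label wraps to 0, matching the return of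
      \<beta> to the base point.\<close>
    have step: "(\<beta> ^^ nat ((i + 1) mod int d)) y = \<beta> ((\<beta> ^^ nat i) y)"
      if "card (orbit \<beta> y) = d" "0 \<le> i" "i < int d" for y i
    proof (cases "i + 1 = int d")
      case True
      then have "Suc (nat i) = d" using that by linarith
      then have "\<beta> ((\<beta> ^^ nat i) y) = y"
        using funpow_onto_orbit(2)[OF perm, of y] that(1) by (metis funpow.simps(2) o_apply)
      then show ?thesis using True by simp
    next
      case False
      then show ?thesis using that by (simp add: nat_add_distrib)
    qed
    have "\<beta> (g k) = g k" if "k \<in> {0..<int f}" for k
    proof -
      have "g k \<in> F" using g that by (auto simp: bij_betw_def)
      then show ?thesis using F1 orbit_eq_singleton_iff by metis
    qed
    then show ?thesis using x step a(2) b(2) by (cases x) (auto simp: \<phi>_def)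
  qed
  ultimately show ?thesis using that by blast
qed

section \<open>Row injectivity and residue arithmetic\<close>

text \<open>Row injectivity is split by the kinds of the two columns, so that each case compares
  entries from two table formulas.\<close>

lemma twisted_op_pointsI:
  assumes closed: "\<And>x y. x \<in> points d f \<Longrightarrow> y \<in> points d f \<Longrightarrow> m x y \<in> points d f"
    and twist: "\<And>x y. x \<in> points d f \<Longrightarrow> y \<in> points d f \<Longrightarrow> m (shift d y) x = shift d (m x y)"
    and AA: "\<And>x i j. x \<in> points d f \<Longrightarrow> 0 \<le> i \<Longrightarrow> i < d \<Longrightarrow> 0 \<le> j \<Longrightarrow> j < d \<Longrightarrow>
      m x (A i) = m x (A j) \<Longrightarrow> i = j"
    and BB: "\<And>x i j. x \<in> points d f \<Longrightarrow> 0 \<le> i \<Longrightarrow> i < d \<Longrightarrow> 0 \<le> j \<Longrightarrow> j < d \<Longrightarrow>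
      m x (B i) = m x (B j) \<Longrightarrow> i = j"
    and II: "\<And>x k l. x \<in> points d f \<Longrightarrow> 0 \<le> k \<Longrightarrow> k < f \<Longrightarrow> 0 \<le> l \<Longrightarrow> l < f \<Longrightarrow>
      m x (Inf k) = m x (Inf l) \<Longrightarrow> k = l"
    and AB: "\<And>x i j. x \<in> points d f \<Longrightarrow> 0 \<le> i \<Longrightarrow> i < d \<Longrightarrow> 0 \<le> j \<Longrightarrow> j < d \<Longrightarrow>
      m x (A i) \<noteq> m x (B j)"
    and AI: "\<And>x i k. x \<in> points d f \<Longrightarrow> 0 \<le> i \<Longrightarrow> i < d \<Longrightarrow> 0 \<le> k \<Longrightarrow> k < f \<Longrightarrow>
      m x (A i) \<noteq> m x (Inf k)"
    and BI: "\<And>x i k. x \<in> points d f \<Longrightarrow> 0 \<le> i \<Longrightarrow> i < d \<Longrightarrow> 0 \<le> k \<Longrightarrow> k < f \<Longrightarrow>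
      m x (B i) \<noteq> m x (Inf k)"
  shows "twisted_op (points d f) (shift d) m"
proof -
  have "y = z" if "x \<in> points d f" "y \<in> points d f" "z \<in> points d f" "m x y = m x z" for x y z
    using that AA[OF that(1)] BB[OF that(1)] II[OF that(1)] AB[OF that(1)] AI[OF that(1)] BI[OF that(1)]
    by (cases y; cases z; metis points_simps)
  then show ?thesis
    unfolding twisted_op_def using closed twist by (auto intro!: inj_onI)
qed

lemma dvd_diff_imp_eq:
  fixes d i j :: int
  assumes "d dvd i - j" "0 \<le> i" "i < d" "0 \<le> j" "j < d"
  shows "i = j"
proof -
  have "i mod d = j mod d" using assms(1) by (simp add: mod_eq_dvd_iff)
  then show ?thesis using assms by simp
qed

text \<open>These are the shapes in which a column index enters a row of the tables below without
  being doubled.\<close>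

lemma mod_cancel:
  fixes d i j y c :: int
  assumes "0 \<le> i" "i < d" "0 \<le> j" "j < d"
  shows "(y + i) mod d = (y + j) mod d \<longleftrightarrow> i = j"
    "(y - i) mod d = (y - j) mod d \<longleftrightarrow> i = j"
    "(y - i - c) mod d = (y - j - c) mod d \<longleftrightarrow> i = j"
    "(1 - (y - i) - c) mod d = (1 - (y - j) - c) mod d \<longleftrightarrow> i = j"
    "(1 - (y - i)) mod d = (1 - (y - j)) mod d \<longleftrightarrow> i = j"
  using dvd_diff_imp_eq[of d i j] dvd_diff_imp_eq[of d j i] assms
  by (auto simp: mod_eq_dvd_iff)

text \<open>In rows \<open>Inf k\<close> the column index enters doubled, and 2 is invertible modulo
  an odd \<open>d\<close>.\<close>

lemma mod_double_cancel:
  fixes d i j c :: int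
  assumes "odd d" "0 \<le> i" "i < d" "0 \<le> j" "j < d"
  shows "(2 * i - c + 1) mod d = (2 * j - c + 1) mod d \<longleftrightarrow> i = j"
proof
  assume "(2 * i - c + 1) mod d = (2 * j - c + 1) mod d"
  then have "d dvd 2 * (i - j)" by (simp add: mod_eq_dvd_iff)
  moreover have "coprime d 2" using \<open>odd d\<close> by simp
  ultimately have "d dvd i - j" using coprime_dvd_mult_right_iff by blast
  then show "i = j" using assms by (auto intro: dvd_diff_imp_eq)
qed simp

text \<open>The index \<open>2 * y - c - k\<close> in column \<open>Inf k\<close> is that of the
  symbol displaced from diagonal \<open>c + k\<close> of row \<open>y\<close>. Meeting it as
  \<open>y + i\<close> places column \<open>i\<close> on that diagonal, where the symbol was
  replaced.\<close>

lemma mod_eq_midpoint_shift: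
  fixes d i k y c :: int
  assumes "(y + i) mod d = (2 * y - c - k) mod d" "0 \<le> k" "k < d"
  shows "(y - i - c) mod d = k"
proof -
  have "d dvd (y + i) - (2 * y - c - k)" using assms(1) by (simp only: mod_eq_dvd_iff)
  also have "(y + i) - (2 * y - c - k) = - ((y - i - c) - k)" by simp
  finally have "(y - i - c) mod d = k mod d" by (simp only: mod_eq_dvd_iff dvd_minus_iff)
  then show ?thesis using assms by simp
qed

lemma mod_eq_midpoint:
  fixes d i k y :: int
  assumes "(y + i) mod d = (2 * y - k) mod d" "0 \<le> k" "k < d"
  shows "(y - i) mod d = k"
  using mod_eq_midpoint_shift[of y i d 0 k] assms by simp

lemma mod_affine_eq:
  fixes a b d u :: int
  shows "(u * (a mod d) + b) mod d = (u * a + b) mod d"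
  by (metis mod_add_left_eq mod_mult_right_eq)

text \<open>These remove the inner reduction that \<open>shift\<close> leaves in an index, in shapes
  occurring in the tables.\<close>

lemma mod_shift_simps:
  fixes a c d i k :: int
  shows "(a mod d - i - c) mod d = (a - i - c) mod d"
    "(i - a mod d - c) mod d = (i - a - c) mod d"
    "(1 - (a mod d - i) - c) mod d = (1 - (a - i) - c) mod d"
    "(1 - (a mod d - i)) mod d = (1 - (a - i)) mod d"
    "(2 * (a mod d) - c - k) mod d = (2 * a - c - k) mod d"
    "(2 * (a mod d) - c) mod d = (2 * a - c) mod d"
  using mod_affine_eq[of 1 a d "- i - c"] mod_affine_eq[of "-1" a d "i - c"]
    mod_affine_eq[of "-1" a d "1 + i - c"] mod_affine_eq[of "-1" a d "1 + i"]
    mod_affine_eq[of 2 a d "- c - k"] mod_affine_eq[of 2 a d "- c"]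
  by (simp_all add: algebra_simps)

section \<open>Construction for at most \<open>d\<close> fixed points\<close>

text \<open>
  The set \<open>D\<close> is the interval \<open>{c..<c + f}\<close> modulo \<open>d\<close>, with \<open>c\<close> chosen such that
  \<open>2 * c + f - 1 = 1\<close> modulo \<open>d\<close>; \<open>Inf k\<close> belongs to \<open>\<delta> = c + k\<close>.
\<close>

fun few_fixed_op :: "int \<Rightarrow> int \<Rightarrow> int \<Rightarrow> point \<Rightarrow> point \<Rightarrow> point" where
  "few_fixed_op d f c (A i) (A j) = A ((i + j) mod d)"
| "few_fixed_op d f c (A i) (B j) =
    (if (i - j - c) mod d < f then Inf ((i - j - c) mod d) else B ((i + j) mod d))"
| "few_fixed_op d f c (B i) (A j) =
    (if (1 - (i - j) - c) mod d < f then Inf ((1 - (i - j) - c) mod d) else B ((i + j) mod d))"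
| "few_fixed_op d f c (B i) (B j) =
    (if (i - j - c) mod d < f then B ((i + j) mod d) else A ((i + j) mod d))"
| "few_fixed_op d f c (A i) (Inf k) = B ((2 * i - c - k) mod d)"
| "few_fixed_op d f c (Inf k) (A i) = B ((2 * i - c - k + 1) mod d)"
| "few_fixed_op d f c (B i) (Inf k) = A ((2 * i - c - k) mod d)"
| "few_fixed_op d f c (Inf k) (B i) = A ((2 * i - c - k + 1) mod d)"
| "few_fixed_op d f c (Inf k) (Inf l) = Inf ((k + l) mod f)"

text \<open>By the congruence, \<open>r\<close> to \<open>1 - r\<close> reverses the interval:
  offset \<open>k\<close> from \<open>c\<close> becomes \<open>f - 1 - k\<close>.\<close>

lemma reflect_mod_less:
  fixes d :: int
  assumes "0 < d" "f \<le> d" "d dvd 2 * c + f - 2" "(r - c) mod d < f"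
  shows "(1 - r - c) mod d < f"
proof -
  let ?k = "(r - c) mod d"
  have "d dvd (r - c) - ?k" by (simp add: minus_mod_eq_mult_div)
  then have "d dvd - ((r - c) - ?k) - (2 * c + f - 2)" using assms(3) by (metis dvd_diff dvd_minus_iff)
  moreover have "- ((r - c) - ?k) - (2 * c + f - 2) = (1 - r - c) - (f - 1 - ?k)" by simp
  ultimately have "(1 - r - c) mod d = (f - 1 - ?k) mod d" by (metis mod_eq_dvd_iff)
  also have "\<dots> = f - 1 - ?k"
    using assms pos_mod_sign[OF assms(1), of "r - c"] by (intro mod_pos_pos_trivial) linarith+
  finally show ?thesis using pos_mod_sign[OF assms(1), of "r - c"] by linarith
qed

lemma reflect_mod_less_iff:
  fixes d :: int
  assumes "0 < d" "f \<le> d" "d dvd 2 * c + f - 2"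
  shows "(1 - r - c) mod d < f \<longleftrightarrow> (r - c) mod d < f"
  using reflect_mod_less[OF assms, of r] reflect_mod_less[OF assms, of "1 - r"] by auto

lemma twisted_few_fixed_op:
  assumes d: "0 < d" and f: "0 \<le> f" "f \<le> d" and c: "f = 0 \<or> odd d \<and> d dvd 2 * c + f - 2"
  shows "twisted_op (points d f) (shift d) (few_fixed_op d f c)"
proof (rule twisted_op_pointsI)
  \<comment> \<open>For \<open>f = 0\<close> both inequalities fail, since residues are
    nonnegative.\<close>
  have refl: "(1 - r - c) mod d < f \<longleftrightarrow> (r - c) mod d < f" for r
    using c reflect_mod_less_iff[OF d f(2), of c r] pos_mod_sign[OF d, of "1 - r - c"]
      pos_mod_sign[OF d, of "r - c"] by linarith
  let ?S = "points d f" and ?m = "few_fixed_op d f c"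
  show "?m x y \<in> ?S" if "x \<in> ?S" "y \<in> ?S" for x y
    using that d by (cases x; cases y) auto
  show "?m (shift d y) x = shift d (?m x y)" if "x \<in> ?S" "y \<in> ?S" for x y
  proof (cases "\<exists>i j. x = B i \<and> y = B j")
    case True
    \<comment> \<open>The twist sends diagonal \<open>i - j\<close> of this block to diagonal
      \<open>1 - (i - j)\<close>, so the set of replaced diagonals must be invariant. The mixed
      blocks have the reflection built into their formulas.\<close>
    then obtain i j where "x = B i" "y = B j" by blast
    then show ?thesis using refl[of "i - j"]
      by (simp only: few_fixed_op.simps shift.simps mod_shift_simps) (simp add: mod_simps algebra_simps)
  next
    case False
    then show ?thesis using that d
      by (cases x; cases y; simp only: few_fixed_op.simps shift.simps mod_shift_simps)
        (auto simp: mod_simps algebra_simps)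
  qed
  show "i = j" if "x \<in> ?S" "0 \<le> i" "i < d" "0 \<le> j" "j < d" "?m x (A i) = ?m x (A j)" for x i j
    using that c
    by (cases x) (auto split: if_splits simp: mod_cancel mod_double_cancel diff_diff_eq[of "2 * _"])
  show "i = j" if "x \<in> ?S" "0 \<le> i" "i < d" "0 \<le> j" "j < d" "?m x (B i) = ?m x (B j)" for x i j
    using that c
    by (cases x) (auto split: if_splits simp: mod_cancel mod_double_cancel diff_diff_eq[of "2 * _"])
  show "k = l" if "x \<in> ?S" "0 \<le> k" "k < f" "0 \<le> l" "l < f" "?m x (Inf k) = ?m x (Inf l)" for x k l
    using that f
    by (cases x) (auto simp: mod_cancel)
  \<comment> \<open>In a row \<open>B\<close>, the \<open>A\<close> columns keep \<open>B\<close>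
    symbols exactly off the chosen diagonals and the \<open>B\<close> columns carry them exactly on
    those; invariance keeps the two sets disjoint.\<close>
  show "?m x (A i) \<noteq> ?m x (B j)" if "x \<in> ?S" "0 \<le> i" "i < d" "0 \<le> j" "j < d" for x i j
    using that refl
    by (cases x) (auto simp: mod_cancel)
  show "?m x (A i) \<noteq> ?m x (Inf k)" if "x \<in> ?S" "0 \<le> i" "i < d" "0 \<le> k" "k < f" for x i k
    using that by (cases x) auto
  show "?m x (B i) \<noteq> ?m x (Inf k)" if "x \<in> ?S" "0 \<le> i" "i < d" "0 \<le> k" "k < f" for x i k
    using that f
    by (cases x) (auto dest!: mod_eq_midpoint_shift)
qed

section \<open>Construction for \<open>d + 1\<close> fixed points\<close>

text \<open>The mixed blocks use up \<open>Inf 0\<close> to \<open>Inf (d - 1)\<close>, one per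
  diagonal; \<open>Inf d\<close> takes diagonal \<open>h\<close>, with \<open>2 * h = 1\<close>
  modulo \<open>d\<close>, in both other blocks. The twist makes the \<open>Inf\<close> block
  commutative, so a cyclic group fits.\<close>

fun many_fixed_op :: "int \<Rightarrow> int \<Rightarrow> point \<Rightarrow> point \<Rightarrow> point" where
  "many_fixed_op d h (A i) (A j) = (if (i - j) mod d = h then Inf d else A ((i + j) mod d))"
| "many_fixed_op d h (B i) (B j) = (if (i - j) mod d = h then Inf d else B ((i + j) mod d))"
| "many_fixed_op d h (A i) (B j) = Inf ((i - j) mod d)"
| "many_fixed_op d h (B i) (A j) = Inf ((1 - (i - j)) mod d)"
| "many_fixed_op d h (A i) (Inf k) = (if k = d then A ((2 * i - h) mod d) else B ((2 * i - k) mod d))"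
| "many_fixed_op d h (B i) (Inf k) = (if k = d then B ((2 * i - h) mod d) else A ((2 * i - k) mod d))"
| "many_fixed_op d h (Inf k) (A i) =
    (if k = d then A ((2 * i - h + 1) mod d) else B ((2 * i - k + 1) mod d))"
| "many_fixed_op d h (Inf k) (B i) =
    (if k = d then B ((2 * i - h + 1) mod d) else A ((2 * i - k + 1) mod d))"
| "many_fixed_op d h (Inf k) (Inf l) = Inf ((k + l) mod (d + 1))"

lemma twisted_many_fixed_op:
  assumes d: "1 < d" and h: "2 * h = d + 1"
  shows "twisted_op (points d (d + 1)) (shift d) (many_fixed_op d h)"
proof (rule twisted_op_pointsI)
  let ?S = "points d (d + 1)" and ?m = "many_fixed_op d h"
  have bound: "a mod d \<le> d" "a mod (d + 1) \<le> d" for a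
    using d pos_mod_bound[of d a] pos_mod_bound[of "d + 1" a] by linarith+
  have odd: "odd d" using h by presburger
  have "0 \<le> h" "h < d" using d h by linarith+
  have refl1: "(1 - r) mod d = h" if "r mod d = h" for r
  proof -
    have "(1 - r) mod d = (1 - h) mod d" using that by (metis mod_diff_right_eq)
    also have "1 - h = h - d" using h by simp
    finally show ?thesis using \<open>0 \<le> h\<close> \<open>h < d\<close> by simp
  qed
  have refl: "(1 - r) mod d = h \<longleftrightarrow> r mod d = h" for r
    using refl1[of r] refl1[of "1 - r"] by auto
  show "?m x y \<in> ?S" if "x \<in> ?S" "y \<in> ?S" for x y
    using that d bound by (cases x; cases y) auto
  show "?m (shift d y) x = shift d (?m x y)" if "x \<in> ?S" "y \<in> ?S" for x y
  proof (cases "\<exists>i j. x = A i \<and> y = A j \<or> x = B i \<and> y = B j")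
    case True
    then obtain i j where "x = A i \<and> y = A j \<or> x = B i \<and> y = B j" by blast
    then show ?thesis using refl[of "i - j"]
      by (elim disjE; clarify; simp only: many_fixed_op.simps shift.simps mod_shift_simps)
        (auto simp: mod_simps algebra_simps)
  next
    case False
    then show ?thesis using that d
      by (cases x; cases y; simp only: many_fixed_op.simps shift.simps mod_shift_simps)
        (auto simp: mod_simps algebra_simps)
  qed
  show "i = j" if "x \<in> ?S" "0 \<le> i" "i < d" "0 \<le> j" "j < d" "?m x (A i) = ?m x (A j)" for x i j
    using that odd
    by (cases x) (auto split: if_splits simp: mod_cancel mod_double_cancel diff_diff_eq[of "2 * _"])
  show "i = j" if "x \<in> ?S" "0 \<le> i" "i < d" "0 \<le> j" "j < d" "?m x (B i) = ?m x (B j)" for x i j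
    using that odd
    by (cases x) (auto split: if_splits simp: mod_cancel mod_double_cancel diff_diff_eq[of "2 * _"])
  show "k = l" if "x \<in> ?S" "0 \<le> k" "k < d + 1" "0 \<le> l" "l < d + 1" "?m x (Inf k) = ?m x (Inf l)" for x k l
    using that
    by (cases x) (auto split: if_splits simp: mod_cancel)
  \<comment> \<open>Residues stay below \<open>d\<close>, so \<open>Inf d\<close> differs from every
    symbol of the mixed blocks.\<close>
  show "?m x (A i) \<noteq> ?m x (B j)" if "x \<in> ?S" "0 \<le> i" "i < d" "0 \<le> j" "j < d" for x i j
    using that d pos_mod_bound[of d] by (cases x) (auto simp: less_imp_neq less_imp_neq[symmetric])
  show "?m x (A i) \<noteq> ?m x (Inf k)" if "x \<in> ?S" "0 \<le> i" "i < d" "0 \<le> k" "k < d + 1" for x i k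
    using that \<open>0 \<le> h\<close> \<open>h < d\<close>
    by (cases x) (auto dest: mod_eq_midpoint)
  show "?m x (B i) \<noteq> ?m x (Inf k)" if "x \<in> ?S" "0 \<le> i" "i < d" "0 \<le> k" "k < d + 1" for x i k
    using that \<open>0 \<le> h\<close> \<open>h < d\<close>
    by (cases x) (auto dest: mod_eq_midpoint)
qed

section \<open>Combining the cases\<close>

lemma ex_twisted_op_points_iff:
  assumes "d > 1"
  shows "(\<exists>m. twisted_op (points (int d) (int f)) (shift (int d)) m) \<longleftrightarrow>
    (even d \<and> f = 0) \<or> (odd d \<and> f \<le> d + 1)"
proof
  assume "\<exists>m. twisted_op (points (int d) (int f)) (shift (int d)) m"
  then show "(even d \<and> f = 0) \<or> (odd d \<and> f \<le> d + 1)"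
    using twisted_op_even_imp twisted_op_odd_imp assms by blast
next
  assume "(even d \<and> f = 0) \<or> (odd d \<and> f \<le> d + 1)"
  then consider "f = 0" | "odd d" "f \<le> d" | "odd d" "f = d + 1" by linarith
  then show "\<exists>m. twisted_op (points (int d) (int f)) (shift (int d)) m"
  proof cases
    case 1
    then show ?thesis using assms twisted_few_fixed_op[of "int d" "int f"] by auto
  next
    case 2
    have "\<exists>c. int d dvd 2 * c + int f - 2"
    proof (cases "even f")
      case True
      then obtain k where "f = 2 * k" by blast
      \<comment> \<open>For even \<open>f\<close> the congruence for \<open>c\<close> is solved
        exactly by \<open>1 - f / 2\<close>; for odd \<open>f\<close>, below, the odd
        \<open>d\<close> repairs the parity and the sum is \<open>d\<close> itself.\<close>
      then have "2 * (1 - int k) + int f - 2 = 0" by simp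
      then show ?thesis by (metis dvd_0_right)
    next
      case False
      then obtain k l where "f = 2 * k + 1" "d = 2 * l + 1" using \<open>odd d\<close> by (meson oddE)
      then have "2 * (1 - int k + int l) + int f - 2 = int d" by simp
      then show ?thesis by (metis dvd_refl)
    qed
    then show ?thesis using 2 assms twisted_few_fixed_op[of "int d" "int f"] by auto
  next
    case 3
    then obtain l where "d = 2 * l + 1" by (meson oddE)
    \<comment> \<open>The diagonal \<open>l + 1\<close> is \<open>(d + 1) / 2\<close>, the inverse
      of 2 modulo \<open>d\<close>.\<close>
    then show ?thesis
      using 3 assms twisted_many_fixed_op[of "int d" "int l + 1"] by auto
  qed
qed

theorem theorem4p14:
  fixes d f n :: nat and \<beta> :: "nat \<Rightarrow> nat"
  assumes "d > 1" and "n = 2 * d + f"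
    and "\<beta> permutes {1..n}"
    and "cycle_structure_d2_1f n \<beta> d f"
  shows "in_Par_12 n id \<beta> \<beta> \<longleftrightarrow> ((even d \<and> f = 0) \<or> (odd d \<and> f \<le> d + 1))"
proof -
  obtain \<phi> where \<phi>: "bij_betw \<phi> (points (int d) (int f)) {1..n}"
    "\<And>x. x \<in> points (int d) (int f) \<Longrightarrow> \<phi> (shift (int d) x) = \<beta> (\<phi> x)"
    using cycle_structure_d2_1f_conjugate_shift[OF assms] by blast
  have "in_Par_12 n id \<beta> \<beta> \<longleftrightarrow> (\<exists>m. twisted_op {1..n} \<beta> m)"
    using assms(3) by (rule in_Par_12_iff_twisted_op)
  also have "\<dots> \<longleftrightarrow> (\<exists>m. twisted_op (points (int d) (int f)) (shift (int d)) m)"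
    using assms(1) by (intro twisted_op_transport[symmetric, OF \<phi>(1)] shift_in_points \<phi>(2)) auto
  also have "\<dots> \<longleftrightarrow> (even d \<and> f = 0) \<or> (odd d \<and> f \<le> d + 1)"
    using assms(1) by (rule ex_twisted_op_points_iff)
  finally show ?thesis .
qed

end
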